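(* Let $\alpha\neq\beta$ be complex numbers and let $N,M:\mathbb{C}^n\to\mathbb{C}^n$ be linear maps with $N^2=M^2=0$. If $$\hat N=\left(\mathrm{Id}+\tfrac{1}{\alpha-\beta}M\right)\left(\mathrm{Id}+\tfrac{1}{(\alpha-\beta)^2}NM\right)^{-1}N\left(\mathrm{Id}-\tfrac{1}{\alpha-\beta}M\right)$$ and $$\hat M=\left(\mathrm{Id}+\tfrac{1}{\beta-\alpha}N\right)\left(\mathrm{Id}+\tfrac{1}{(\beta-\alpha)^2}MN\right)^{-1}M\left(\mathrm{Id}-\tfrac{1}{\beta-\alpha}N\right)$$ are well-defined (i.e. the inverses exist), then $$m_{\beta,1,\hat M}\,m_{\alpha,1,N}=m_{\alpha,1,\hat N}\,m_{\beta,1,M}.$$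
   Context: For $\gamma\in\mathbb{C}$ and a linear map $P$ on $\mathbb{C}^n$, $m_{\gamma,1,P}(\lambda)=\mathrm{Id}+\frac{1}{\lambda-\gamma}P$ as a matrix-valued rational function of $\lambda$. The product is the pointwise product. *)

theory Defs
  imports "HOL-Analysis.Analysis"
begin

text \<open>
  Linear maps on \<open>n\<close>-dimensional complex space are given by their matrices with respect to the
  standard basis, so composition is the matrix product \<open>**\<close>.  The library scales such matrices
  only by reals (\<open>*\<^sub>R\<close>); the operator \<open>*s\<close> on this type would expect a vector as scalar.
\<close>

definition scaleC_mat :: "complex \<Rightarrow> complex^'n^'m \<Rightarrow> complex^'n^'m" (infixr "*\<^sub>C" 75)
  where "c *\<^sub>C A = (\<chi> i j. c * A $ i $ j)"

text \<open>
  The second index of \<open>m\<^bsub>\<gamma>,1,P\<^esub>\<close> is always \<open>1\<close> here and is omitted.  The value at the pole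
  \<open>\<lambda> = \<gamma>\<close> is an artefact of division by zero and carries no meaning.
\<close>

definition simple_element :: "complex \<Rightarrow> complex^'n^'n \<Rightarrow> complex \<Rightarrow> complex^'n^'n"
  where "simple_element \<gamma> P l = mat 1 + (1 / (l - \<gamma>)) *\<^sub>C P"

end

theory Submission
  imports Defs
begin

text \<open>
  Put \<open>d = \<alpha> - \<beta>\<close>, \<open>n = N / d\<close> and \<open>m = M / d\<close>.  Since
  \<open>d / (\<lambda> - \<alpha>) - d / (\<lambda> - \<beta>)\<close> equals the product of the two fractions, comparing coefficients
  reduces the claim to two identities in the algebra generated by \<open>n\<close>, \<open>m\<close>,
  \<open>U = (1 + n m)\<^sup>-\<^sup>1\<close> and \<open>V = (1 + m n)\<^sup>-\<^sup>1\<close>; they follow from \<open>m U = V m\<close> and \<open>U n = n V\<close>.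
\<close>

lemma scaleC_mat_component [simp]: "(c *\<^sub>C A) $ i $ j = c * A $ i $ j"
  by (simp add: scaleC_mat_def)

lemma scaleC_mat_minus_left: "(- c) *\<^sub>C A = - (c *\<^sub>C A)"
  by (simp add: vec_eq_iff)

lemma scaleC_mat_scaleC_mat [simp]: "c *\<^sub>C (d *\<^sub>C A) = (c * d) *\<^sub>C A"
  by (simp add: vec_eq_iff algebra_simps)

lemma scaleC_mat_one [simp]: "1 *\<^sub>C A = A"
  by (simp add: vec_eq_iff)

lemma scaleC_mat_zero_right [simp]: "c *\<^sub>C 0 = 0"
  by (simp add: vec_eq_iff)

lemma matrix_mul_scaleC_left [simp]:
  fixes A :: "complex^'n^'m" and B :: "complex^'k^'n"
  shows "(c *\<^sub>C A) ** B = c *\<^sub>C (A ** B)"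
  by (simp add: vec_eq_iff matrix_matrix_mult_def sum_distrib_left algebra_simps)

lemma matrix_mul_scaleC_right [simp]:
  fixes A :: "complex^'n^'m" and B :: "complex^'k^'n"
  shows "A ** (c *\<^sub>C B) = c *\<^sub>C (A ** B)"
  by (simp add: vec_eq_iff matrix_matrix_mult_def sum_distrib_left algebra_simps)

lemma matrix_add_rdistrib:
  fixes A B :: "'a::semiring_1^'n^'m" and C :: "'a^'k^'n"
  shows "(A + B) ** C = A ** C + B ** C"
  by (simp add: vec_eq_iff matrix_matrix_mult_def sum.distrib algebra_simps)

lemma matrix_diff_ldistrib:
  fixes A :: "'a::ring_1^'n^'m" and B C :: "'a^'k^'n"
  shows "A ** (B - C) = A ** B - A ** C"
  by (simp add: vec_eq_iff matrix_matrix_mult_def sum_subtractf algebra_simps)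

lemma matrix_diff_rdistrib:
  fixes A B :: "'a::ring_1^'n^'m" and C :: "'a^'k^'n"
  shows "(A - B) ** C = A ** C - B ** C"
  by (simp add: vec_eq_iff matrix_matrix_mult_def sum_subtractf algebra_simps)

lemmas matrix_distribs =
  matrix_add_ldistrib matrix_add_rdistrib matrix_diff_ldistrib matrix_diff_rdistrib

text \<open>Both (1 + AB)A and A(1 + BA) are A + ABA; cancel \<open>U\<close> on the left and
  \<open>V\<close> on the right.\<close>

lemma inverse_one_plus_mul_intertwines:
  fixes A B :: "'a::comm_ring_1^'n^'n"
  assumes "U ** (mat 1 + A ** B) = mat 1" and "(mat 1 + B ** A) ** V = mat 1"
  shows "U ** A = A ** V"
proof -
  have "U ** A = U ** (A ** ((mat 1 + B ** A) ** V))"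
    by (simp add: assms)
  also have "\<dots> = U ** (mat 1 + A ** B) ** (A ** V)"
    by (simp add: matrix_distribs matrix_mul_assoc)
  finally show ?thesis by (simp add: assms)
qed

text \<open>These are the coefficients of a and b when (1 + a m')(1 + b n) = (1 + b n')(1 + a m) is
  expanded with ab = b - a.\<close>

lemma normalized_dressing_identities:
  fixes m n U V :: "'a::comm_ring_1^'k^'k"
  assumes n: "n ** n = 0" and m: "m ** m = 0"
    and U: "U ** (mat 1 + n ** m) = mat 1" "(mat 1 + n ** m) ** U = mat 1"
    and V: "V ** (mat 1 + m ** n) = mat 1" "(mat 1 + m ** n) ** V = mat 1"
  defines "n' \<equiv> (mat 1 + m) ** U ** n ** (mat 1 - m)"
    and "m' \<equiv> (mat 1 - n) ** V ** m ** (mat 1 + n)"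
  shows "m' - m' ** n = m - n' ** m" and "n + m' ** n = n' + n' ** m"
proof -
  have Un: "U ** n = n ** V" and Vm: "V ** m = m ** U"
    using inverse_one_plus_mul_intertwines U V by blast+
  have Unm: "U ** n ** m = mat 1 - U" and nmU: "n ** m ** U = mat 1 - U"
    using U by (simp_all add: matrix_distribs matrix_mul_assoc eq_diff_eq add.commute)
  have Vmn: "V ** m ** n = mat 1 - V" and mnV: "m ** n ** V = mat 1 - V"
    using V by (simp_all add: matrix_distribs matrix_mul_assoc eq_diff_eq add.commute)
  \<comment> \<open>Nilpotency makes 1 + n and 1 - n mutually inverse, and likewise for
    \<open>m\<close>. So the last factor of \<open>m'\<close> and of \<open>n'\<close> disappears in
    the products needed below.\<close>
  have "(mat 1 + n) ** n = n" "(mat 1 - m) ** m = m"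
    and "(mat 1 + n) ** (mat 1 - n) = mat 1" "(mat 1 - m) ** (mat 1 + m) = mat 1"
    using n m by (simp_all add: matrix_distribs)
  then have m'n: "m' ** n = (mat 1 - n) ** (V ** m ** n)"
    and n'm: "n' ** m = (mat 1 + m) ** (U ** n ** m)"
    and m'1: "m' ** (mat 1 - n) = (mat 1 - n) ** (V ** m)"
    and n'1: "n' ** (mat 1 + m) = (mat 1 + m) ** (U ** n)"
    unfolding m'_def n'_def by (simp_all flip: matrix_mul_assoc)
  \<comment> \<open>Both sides equal (1 + m)U - 1: the left is (1 - n)mU, the right is m - (1 + m)(1
    - U).\<close>
  have "m' ** (mat 1 - n) = m - n' ** m"
    unfolding m'1 n'm Unm Vm using nmU
    by (simp add: matrix_distribs matrix_mul_assoc)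
  then show "m' - m' ** n = m - n' ** m"
    by (simp add: matrix_distribs)
  \<comment> \<open>Both sides equal 1 - (1 - n)V: the left is n + (1 - n)(1 - V), the right is (1 +
    m)nV.\<close>
  have "n + m' ** n = n' ** (mat 1 + m)"
    unfolding n'1 m'n Vmn using mnV
    by (simp add: Un matrix_distribs matrix_mul_assoc)
  then show "n + m' ** n = n' + n' ** m"
    by (simp add: matrix_distribs)
qed

lemma matrix_inv_inverse:
  fixes A :: "'a::semiring_1^'n^'m"
  assumes "invertible A"
  shows "matrix_inv A ** A = mat 1" "A ** matrix_inv A = mat 1"
  using someI_ex[OF assms[unfolded invertible_def]] by (simp_all add: matrix_inv_def)

theorem proposition5p4:
  fixes \<alpha> \<beta> :: complex
    and N M N_hat M_hat :: "complex^'n^'n"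
  assumes "\<alpha> \<noteq> \<beta>"
    and "N ** N = 0"
    and "M ** M = 0"
    and "invertible (mat 1 + (1 / (\<alpha> - \<beta>)^2) *\<^sub>C (N ** M))"
    and "invertible (mat 1 + (1 / (\<beta> - \<alpha>)^2) *\<^sub>C (M ** N))"
    and "N_hat = (mat 1 + (1 / (\<alpha> - \<beta>)) *\<^sub>C M)
                  ** matrix_inv (mat 1 + (1 / (\<alpha> - \<beta>)^2) *\<^sub>C (N ** M))
                  ** N ** (mat 1 - (1 / (\<alpha> - \<beta>)) *\<^sub>C M)"
    and "M_hat = (mat 1 + (1 / (\<beta> - \<alpha>)) *\<^sub>C N)
                  ** matrix_inv (mat 1 + (1 / (\<beta> - \<alpha>)^2) *\<^sub>C (M ** N))
                  ** M ** (mat 1 - (1 / (\<beta> - \<alpha>)) *\<^sub>C N)"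
  shows "\<forall>l. l \<noteq> \<alpha> \<longrightarrow> l \<noteq> \<beta> \<longrightarrow>
           simple_element \<beta> M_hat l ** simple_element \<alpha> N l
           = simple_element \<alpha> N_hat l ** simple_element \<beta> M l"
proof (intro allI impI)
  fix l assume l: "l \<noteq> \<alpha>" "l \<noteq> \<beta>"
  define d n m where "d = \<alpha> - \<beta>" and "n = (1 / d) *\<^sub>C N" and "m = (1 / d) *\<^sub>C M"
  define U V where "U = matrix_inv (mat 1 + n ** m)" and "V = matrix_inv (mat 1 + m ** n)"
  define n' m' where "n' = (mat 1 + m) ** U ** n ** (mat 1 - m)"
    and "m' = (mat 1 - n) ** V ** m ** (mat 1 + n)"
  \<comment> \<open>The factor \<open>d\<close> lost in passing to \<open>n\<close> and
    \<open>m\<close> is absorbed here, so the simple elements become 1 + a m', 1 + b n and so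
    on.\<close>
  define a b where "a = d / (l - \<beta>)" and "b = d / (l - \<alpha>)"
  have d: "d \<noteq> 0" using assms(1) by (simp add: d_def)
  \<comment> \<open>This sign is why \<open>m'\<close> starts with 1 - n and ends with 1 + n,
    opposite to \<open>n'\<close>.\<close>
  have inv_d: "1 / (\<beta> - \<alpha>) = - (1 / d)"
    by (simp add: d_def divide_simps)
  have sq_d: "(\<beta> - \<alpha>)\<^sup>2 = d\<^sup>2"
    by (simp add: d_def power2_commute)
  have nm: "(1 / d\<^sup>2) *\<^sub>C (N ** M) = n ** m" "(1 / d\<^sup>2) *\<^sub>C (M ** N) = m ** n"
    by (simp_all add: n_def m_def power2_eq_square)
  have "U ** (mat 1 + n ** m) = mat 1" "(mat 1 + n ** m) ** U = mat 1"
    "V ** (mat 1 + m ** n) = mat 1" "(mat 1 + m ** n) ** V = mat 1"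
    using assms(4,5) unfolding U_def V_def sq_d d_def[symmetric] nm by (auto intro: matrix_inv_inverse)
  moreover have "n ** n = 0" "m ** m = 0"
    using assms(2,3) by (simp_all add: n_def m_def)
  ultimately have id: "m' - m' ** n = m - n' ** m" "n + m' ** n = n' + n' ** m"
    unfolding m'_def n'_def using normalized_dressing_identities by blast+
  have NM: "N = d *\<^sub>C n" "M = d *\<^sub>C m"
    using d by (simp_all add: n_def m_def)
  \<comment> \<open>Only the factor \<open>N\<close> in the middle is not yet normalized, which
    leaves a single \<open>d\<close>.\<close>
  have N_hat: "N_hat = d *\<^sub>C n'"
    unfolding assms(6) d_def[symmetric] nm n'_def U_def[symmetric] m_def[symmetric]
    by (simp add: NM(1))
  have M_hat: "M_hat = d *\<^sub>C m'"
    unfolding assms(7) sq_d inv_d nm m'_def V_def[symmetric] scaleC_mat_minus_left n_def[symmetric]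
    by (simp add: NM(2))
  \<comment> \<open>Away from both poles, 1/a - 1/b = ((l - \<beta>) - (l - \<alpha>))/d = 1. At a
    pole, division by zero would break this.\<close>
  have "a * b = b - a"
    using l by (simp add: a_def b_def d_def field_simps)
  then have ab: "a * (b * x) = b * x - a * x" for x
    by (metis left_diff_distrib mult.assoc)
  \<comment> \<open>Entrywise, \<open>ab\<close> removes the mixed term and leaves an expression
    linear in \<open>a\<close> and \<open>b\<close>.\<close>
  have "(mat 1 + a *\<^sub>C m') ** (mat 1 + b *\<^sub>C n)
      = mat 1 + a *\<^sub>C (m' - m' ** n) + b *\<^sub>C (n + m' ** n)"
    by (simp add: matrix_distribs vec_eq_iff algebra_simps ab)
  also have "\<dots> = (mat 1 + b *\<^sub>C n') ** (mat 1 + a *\<^sub>C m)"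
    unfolding id by (simp add: matrix_distribs vec_eq_iff algebra_simps ab)
  finally show "simple_element \<beta> M_hat l ** simple_element \<alpha> N l
      = simple_element \<alpha> N_hat l ** simple_element \<beta> M l"
    by (simp add: simple_element_def N_hat M_hat NM a_def b_def)
qed

end
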